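(* Let $u,v:\mathbb{R}^p\to\mathbb{R}$ be convex, let $c_1,\dots,c_n:\mathbb{R}^p\to\mathbb{R}$ be convex, and let $d_1,\dots,d_m:\mathbb{R}^p\to\mathbb{R}$ be affine. Let $\mathcal C=\{w\in\mathbb{R}^p: c_i(w)\le0\ (i=1,\dots,n),\ d_j(w)=0\ (j=1,\dots,m)\}$, let $\delta_{\mathcal C}$ be its indicator function ($0$ on $\mathcal C$, $+\infty$ outside $\mathcal C$), and define $F=\delta_{\mathcal C}+u-v:\mathbb{R}^p\to(-\infty,+\infty]$. Assume: (a) $F$ is lower semi-continuous and coercive (i.e. $F(w)\to\infty$ as $\|w\|\to\infty$), and $\inf_{w}F(w)>-\infty$; (b) $u$ and $v$ are $C^1$ functions, $u$ is $\gamma$-strongly convex for some $\gamma>0$, and $\nabla v$ is Lipschitz continuous; (c) $F$ has the Kurdyka-Łojasiewicz property at each point of $\operatorname{dom}\partial F$. Let $(w^{(k)})_{k\ge0}$ be a sequence in $\mathbb{R}^p$ satisfying, for all $k\ge0$, $$w^{(k+1)}=\operatorname{argmin}_{w}\{\delta_{\mathcal C}(w)+u(w)-\nabla v(w^{(k)})^Tw\}.$$ Then: (1) $\sum_{k=0}^\infty\|w^{(k+1)}-w^{(k)}\|<\infty$. (2) $(w^{(k)})$ converges to a critical point $w^*$ of $F$. (3) Suppose moreover that the Kurdyka-Łojasiewicz property of $F$ at each point of $\operatorname{dom}\partial F$ holds with $\phi(t)=ct^{1-\theta}$, where $c>0$ and $\theta\in[0,1)$. Then: - if $\theta=0$, $(w^{(k)})$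 converges to $w^*$ in finitely many iterations; - if $\theta\in(0,\frac12]$, there exist $K_0>0$, $C>0$ and $\rho\in(0,1)$ with $\|w^{(k)}-w^*\|\le C\rho^k$ for all $k\ge K_0$; - if $\theta\in(\frac12,1)$, there exist $K_0>0$ and $C>0$ with $\|w^{(k)}-w^*\|\le Ck^{-\frac{1-\theta}{2\theta-1}}$ for all $k\ge K_0$.
   Context: $\|\cdot\|$ is the Euclidean norm. For a proper lower semi-continuous $F:\mathbb{R}^p\to(-\infty,+\infty]$ and $x\in\operatorname{dom}F=\{x:F(x)<+\infty\}$, the Fréchet subdifferential $\hat\partial F(x)$ is the set of $g\in\mathbb{R}^p$ with $\liminf_{y\to x,\,y\ne x}\frac{F(y)-F(x)-g^T(y-x)}{\|y-x\|}\ge0$; for $x\notin\operatorname{dom}F$ it is empty. The limiting subdifferential is $\partial F(x)=\{g:\exists\,x_k\to x,\ F(x_k)\to F(x),\ g_k\in\hat\partial F(x_k),\ g_k\to g\}$. Let $\operatorname{dom}\partial F=\{x:\partial F(x)\neq\emptyset\}$. A point $x^*$ is a critical point of $F$ if $0\in\partial F(x^* )$. A proper lower semi-continuous $F$ has the Kurdyka-Łojasiewicz property at $\bar x\in\operatorname{dom}\partial F$ if there exist $\eta\in(0,+\infty]$, a neighborhood $\mathcal U$ of $\bar x$, and a continuous concave function $\phi:[0,\eta)\to[0,\infty)$ with $\phi(0)=0$, $\phi$ of class $C^1$ on $(0,\eta)$, and $\phi'(t)>0$ for all $t\in(0,\eta)$, such that for all $x\in\mathcal U$ with $F(\bar x)<F(x)<F(\bar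 x)+\eta$, $$\phi'(F(x)-F(\bar x))\,\operatorname{dist}(0,\partial F(x))\ge1,$$ where $\operatorname{dist}(x,A)=\inf_{y\in A}\|x-y\|$. The property "holds with $\phi(t)=ct^{1-\theta}$" if $\phi$ can be taken of this form. In particular, having the property includes that $F$ is proper. *)

theory Defs
  imports "HOL-Analysis.Analysis"
begin

text \<open>
  Functions with values in \<open>(-\<infinity>, +\<infinity>]\<close> are functions into \<^typ>\<open>ereal\<close> that are \<open>proper\<close>.
\<close>

definition eff_dom :: "('a \<Rightarrow> ereal) \<Rightarrow> 'a set" where
  "eff_dom F = {x. F x < \<infinity>}"

definition proper :: "('a \<Rightarrow> ereal) \<Rightarrow> bool" where
  "proper F \<longleftrightarrow> (\<forall>x. F x \<noteq> -\<infinity>) \<and> eff_dom F \<noteq> {}"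

definition lsc :: "('a::topological_space \<Rightarrow> ereal) \<Rightarrow> bool" where
  "lsc F \<longleftrightarrow> (\<forall>x. F x \<le> Liminf (at x) F)"

definition coercive :: "('a::real_normed_vector \<Rightarrow> ereal) \<Rightarrow> bool" where
  "coercive F \<longleftrightarrow> (F \<longlongrightarrow> \<infinity>) at_infinity"

definition indicator_infty :: "'a set \<Rightarrow> 'a \<Rightarrow> ereal" where
  "indicator_infty C x = (if x \<in> C then 0 else \<infinity>)"

definition frechet_subdiff :: "('a::real_inner \<Rightarrow> ereal) \<Rightarrow> 'a \<Rightarrow> 'a set" where
  "frechet_subdiff F x =
     (if x \<in> eff_dom F
      then {g. 0 \<le> Liminf (at x)
                 (\<lambda>y. (F y - F x - ereal (g \<bullet> (y - x))) / ereal (norm (y - x)))}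
      else {})"

definition limiting_subdiff :: "('a::real_inner \<Rightarrow> ereal) \<Rightarrow> 'a \<Rightarrow> 'a set" where
  "limiting_subdiff F x =
     {g. \<exists>xs gs. xs \<longlonglongrightarrow> x \<and> (\<lambda>k. F (xs k)) \<longlonglongrightarrow> F x \<and>
           (\<forall>k. gs k \<in> frechet_subdiff F (xs k)) \<and> gs \<longlonglongrightarrow> g}"

definition dom_subdiff :: "('a::real_inner \<Rightarrow> ereal) \<Rightarrow> 'a set" where
  "dom_subdiff F = {x. limiting_subdiff F x \<noteq> {}}"

definition critical_point :: "('a::real_inner \<Rightarrow> ereal) \<Rightarrow> 'a \<Rightarrow> bool" where
  "critical_point F x \<longleftrightarrow> 0 \<in> limiting_subdiff F x"

text \<open>
  The library function \<^const>\<open>infdist\<close> is not used because it sets the distance to the empty set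
  to \<open>0\<close>; here that distance is \<open>\<infinity>\<close>.
\<close>

definition edist_set :: "'a::real_normed_vector \<Rightarrow> 'a set \<Rightarrow> ereal" where
  "edist_set x A = (INF y\<in>A. ereal (norm (x - y)))"

text \<open>
  A function \<open>\<phi> : [0, \<eta>) \<Rightarrow> [0, \<infinity>)\<close> is represented by a total function of which only the values
  on \<open>[0, \<eta>)\<close> matter; \<open>\<eta>\<close> may be \<open>\<infinity>\<close>.
\<close>

definition desingularizing :: "ereal \<Rightarrow> (real \<Rightarrow> real) \<Rightarrow> bool" where
  "desingularizing \<eta> \<phi> \<longleftrightarrow>
     (let I = {t. 0 \<le> t \<and> ereal t < \<eta>}; J = {t. 0 < t \<and> ereal t < \<eta>} in
        (\<forall>t\<in>I. 0 \<le> \<phi> t) \<and> continuous_on I \<phi> \<and> concave_on I \<phi> \<and> \<phi> 0 = 0 \<and>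
        (\<forall>t\<in>J. \<phi> differentiable (at t)) \<and> continuous_on J (deriv \<phi>) \<and>
        (\<forall>t\<in>J. 0 < deriv \<phi> t))"

definition KL_with :: "('a::real_inner \<Rightarrow> ereal) \<Rightarrow> 'a \<Rightarrow> (real \<Rightarrow> real) \<Rightarrow> bool" where
  "KL_with F xbar \<phi> \<longleftrightarrow>
     proper F \<and> lsc F \<and> xbar \<in> dom_subdiff F \<and>
     (\<exists>\<eta> U. 0 < \<eta> \<and> desingularizing \<eta> \<phi> \<and> open U \<and> xbar \<in> U \<and>
        (\<forall>x\<in>U. F xbar < F x \<and> F x < F xbar + \<eta> \<longrightarrow>
           1 \<le> ereal (deriv \<phi> (real_of_ereal (F x - F xbar))) * edist_set 0 (limiting_subdiff F x)))"

definition KL_at :: "('a::real_inner \<Rightarrow> ereal) \<Rightarrow> 'a \<Rightarrow> bool" where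
  "KL_at F xbar \<longleftrightarrow> (\<exists>\<phi>. KL_with F xbar \<phi>)"

definition grad :: "('a::real_inner \<Rightarrow> real) \<Rightarrow> 'a \<Rightarrow> 'a" where
  "grad f x = (THE g. GDERIV f x :> g)"

definition C1_fun :: "('a::real_inner \<Rightarrow> real) \<Rightarrow> bool" where
  "C1_fun f \<longleftrightarrow> (\<forall>x. f differentiable (at x)) \<and> continuous_on UNIV (grad f)"

definition strongly_convex :: "real \<Rightarrow> ('a::real_normed_vector \<Rightarrow> real) \<Rightarrow> bool" where
  "strongly_convex \<gamma> f \<longleftrightarrow>
     (\<forall>x y. \<forall>t\<in>{0..1}.
        f (t *\<^sub>R x + (1 - t) *\<^sub>R y)
          \<le> t * f x + (1 - t) * f y - \<gamma> / 2 * t * (1 - t) * (norm (x - y))\<^sup>2)"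

definition affine_fun :: "('a::real_inner \<Rightarrow> real) \<Rightarrow> bool" where
  "affine_fun f \<longleftrightarrow> (\<exists>a b. \<forall>x. f x = a \<bullet> x + b)"

definition feasible_set ::
  "nat \<Rightarrow> nat \<Rightarrow> (nat \<Rightarrow> 'a \<Rightarrow> real) \<Rightarrow> (nat \<Rightarrow> 'a \<Rightarrow> real) \<Rightarrow> 'a set" where
  "feasible_set n m c d = {w. (\<forall>i\<in>{1..n}. c i w \<le> 0) \<and> (\<forall>j\<in>{1..m}. d j w = 0)}"

definition dc_objective :: "'a set \<Rightarrow> ('a \<Rightarrow> real) \<Rightarrow> ('a \<Rightarrow> real) \<Rightarrow> 'a \<Rightarrow> ereal" where
  "dc_objective C u v w = indicator_infty C w + ereal (u w) - ereal (v w)"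

end

theory Submission
  imports Defs
begin

text \<open>
  Write \<open>F = u - v\<close> on \<open>C\<close>. Each step minimizes \<open>u\<close> minus the linearization of \<open>v\<close> over \<open>C\<close>, which has
  three consequences for consecutive iterates.

  \<^item> Sufficient decrease: strong convexity of \<open>u\<close> makes the subproblem grow quadratically around its
    minimizer, and \<open>v\<close> lies above its linearization, so
    \<open>F(w(k+1)) + \<gamma>/2 |w(k+1) - w(k)|^2 \<le> F(w(k))\<close> for \<open>k \<ge> 1\<close>, when \<open>w(k)\<close> is feasible (\<open>descent\<close>).
  \<^item> Small subgradients: \<open>grad v(w(k)) - grad v(w(k+1))\<close> is a Frechet subgradient of \<open>F\<close> at \<open>w(k+1)\<close>
    (\<open>gradient_gap_in_subdiff\<close>), and its norm is at most \<open>L |w(k+1) - w(k)|\<close>.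
  \<^item> Cluster points: coercivity and the decrease keep the iterates bounded, steps tend to \<open>0\<close>, and
    \<open>F\<close> is continuous on the closed set \<open>C\<close>, so the iterates have a cluster point, it is critical,
    and its value is the limit of the values (\<open>critical_cluster_point\<close>).

  The Kurdyka-Lojasiewicz inequality at a cluster point \<open>z\<close> turns this into convergence. With
  \<open>r(k) = F(w(k)) - F(z)\<close> it says \<open>1 \<le> \<phi>'(r(k)) L |w(k) - w(k-1)|\<close> as long as \<open>w(k)\<close> is close to \<open>z\<close>
  and \<open>r(k)\<close> is positive and small. Concavity of \<open>\<phi>\<close> and the sufficient
  decrease then show that the energy \<open>E(k) = |w(k+1) - w(k)| + 2L/\<gamma> \<phi>(r(k+1))\<close> drops in each step by
  at least the length of the next step (\<open>KL_energy_step\<close>). Hence the iterates cannot leave a small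
  ball around \<open>z\<close> once they are deep inside it, the path has finite length, it converges to \<open>z\<close>, and
  the distance of \<open>w(k+1)\<close> to \<open>z\<close> is eventually at most \<open>E(k)\<close> (\<open>KL_finite_length\<close>).

  For \<open>\<phi>(t) = a t^(1-\<theta>)\<close> the inequality, squared and combined with the decrease, becomes the recursion
  \<open>r(k+1)^(2\<theta>) \<le> A (r(k) - r(k+1))\<close>. Its solutions vanish after finitely many steps for \<open>\<theta> = 0\<close>, decay
  geometrically for \<open>\<theta> \<le> 1/2\<close>, and decay like \<open>k^(-1/(2\<theta>-1))\<close> for \<open>\<theta> > 1/2\<close>. The bound by \<open>E(k)\<close> gives
  \<open>|w(k+1) - z| \<le> D r(k)^min(1/2, 1-\<theta>)\<close>, which carries these rates over to the
  iterates (\<open>rates_from_KL_recursion\<close>).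
\<close>

section \<open>Convex analysis of the subproblem\<close>

text \<open>
  The derivative is a linear functional, which its coordinates represent as an inner product; since
  \<open>grad\<close> is a definite description, the representing vector must also be shown to be unique.
\<close>

lemma GDERIV_grad:
  fixes f :: "'a::euclidean_space \<Rightarrow> real"
  assumes "f differentiable (at x)"
  shows "GDERIV f x :> grad f x"
proof -
  from assms obtain D where D: "(f has_derivative D) (at x)"
    by (auto simp: differentiable_def)
  then have "linear D"
    by (rule has_derivative_linear)
  define g where "g = (\<Sum>b\<in>Basis. D b *\<^sub>R b)"
  have "D h = h \<bullet> g" for h
  proof -
    have "D h = D (\<Sum>b\<in>Basis. (h \<bullet> b) *\<^sub>R b)"
      by (simp add: euclidean_representation)
    also have "\<dots> = h \<bullet> g"
      using \<open>linear D\<close> by (simp add: linear_sum linear_scale g_def inner_sum_right mult.commute)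
    finally show ?thesis .
  qed
  then have "D = (\<lambda>h. h \<bullet> g)"
    by (rule ext)
  then have "GDERIV f x :> g"
    using D by (simp add: gderiv_def)
  moreover have "g' = g" if "GDERIV f x :> g'" for g'
  proof -
    have "(\<lambda>h. h \<bullet> g') = (\<lambda>h. h \<bullet> g)"
      using that \<open>GDERIV f x :> g\<close> unfolding gderiv_def by (rule has_derivative_unique)
    then have "(g' - g) \<bullet> g' = (g' - g) \<bullet> g"
      by meson
    then have "(g' - g) \<bullet> (g' - g) = 0"
      by (simp add: inner_diff_right)
    then show ?thesis
      by simp
  qed
  ultimately show ?thesis
    unfolding grad_def by (metis theI)
qed

text \<open>
  Restricting to the line through the two points reduces this to a convex function of one variable.
\<close>

lemma convex_on_above_gradient:
  fixes f :: "'a::real_inner \<Rightarrow> real"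
  assumes "convex_on UNIV f" and g: "GDERIV f x :> g"
  shows "f x + g \<bullet> (y - x) \<le> f y"
proof -
  let ?l = "\<lambda>t::real. x + t *\<^sub>R (y - x)"
  have "convex_on UNIV (\<lambda>t. f (?l t))"
  proof (rule convex_onI)
    fix t a b :: real
    assume "0 < t" "t < 1"
    have "?l ((1 - t) *\<^sub>R a + t *\<^sub>R b) = (1 - t) *\<^sub>R ?l a + t *\<^sub>R ?l b"
      by (simp add: algebra_simps)
    then show "f (?l ((1 - t) *\<^sub>R a + t *\<^sub>R b)) \<le> (1 - t) * f (?l a) + t * f (?l b)"
      using convex_onD[OF assms(1), of t "?l a" "?l b"] \<open>0 < t\<close> \<open>t < 1\<close> by simp
  qed simp
  moreover have "((\<lambda>t. f (?l t)) has_derivative (\<lambda>t. (t *\<^sub>R (y - x)) \<bullet> g)) (at 0)"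
  proof (rule has_derivative_compose[where f = ?l and g = f])
    show "(?l has_derivative (\<lambda>t. t *\<^sub>R (y - x))) (at 0)"
      by (auto intro!: derivative_eq_intros)
    show "(f has_derivative (\<lambda>h. h \<bullet> g)) (at (?l 0))"
      using g by (simp add: gderiv_def)
  qed
  then have "((\<lambda>t. f (?l t)) has_field_derivative (g \<bullet> (y - x))) (at 0)"
    by (simp add: has_field_derivative_def inner_commute mult_commute_abs)
  ultimately have "f (?l 1) - f (?l 0) \<ge> g \<bullet> (y - x) * (1 - 0)"
    by (intro convex_on_imp_above_tangent[where A = UNIV and f = "\<lambda>t. f (?l t)"]) auto
  then show ?thesis
    by simp
qed

text \<open>
  This replaces the optimality condition of the subproblem: comparing the minimizer with the points
  of the segment towards \<open>y\<close> and letting them tend to the minimizer gives the subgradient inequality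
  together with the quadratic growth.
\<close>

lemma strongly_convex_minimizer_growth:
  fixes u :: "'a::real_inner \<Rightarrow> real"
  assumes u: "strongly_convex \<gamma> u" and C: "convex C" "x \<in> C" "y \<in> C"
    and min: "\<And>z. z \<in> C \<Longrightarrow> u x - h \<bullet> x \<le> u z - h \<bullet> z"
  shows "u x + h \<bullet> (y - x) + \<gamma> / 2 * (norm (y - x))\<^sup>2 \<le> u y"
proof -
  have "s * (\<gamma> / 2 * (norm (y - x))\<^sup>2) \<le> u y - u x - h \<bullet> (y - x)" if s: "0 < s" "s < 1" for s
  proof -
    define t where "t = 1 - s"
    have t: "0 < t" "t < 1" "s = 1 - t"
      using s by (auto simp: t_def)
    let ?z = "t *\<^sub>R y + (1 - t) *\<^sub>R x"
    have "?z \<in> C"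
      using C t by (simp add: convexD)
    then have "u x - h \<bullet> x \<le> u ?z - h \<bullet> ?z"
      by (rule min)
    also have "u ?z \<le> t * u y + (1 - t) * u x - \<gamma> / 2 * t * (1 - t) * (norm (y - x))\<^sup>2"
      using u t by (simp add: strongly_convex_def)
    finally have "t * (s * (\<gamma> / 2 * (norm (y - x))\<^sup>2)) \<le> t * (u y - u x - h \<bullet> (y - x))"
      by (simp add: t algebra_simps)
    then show ?thesis
      using t by simp
  qed
  then have "\<gamma> / 2 * (norm (y - x))\<^sup>2 \<le> u y - u x - h \<bullet> (y - x)"
    by (rule field_le_mult_one_interval)
  then show ?thesis
    by simp
qed

lemma dc_objective_on: "x \<in> C \<Longrightarrow> dc_objective C u v x = ereal (u x - v x)"
  by (simp add: dc_objective_def indicator_infty_def)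

lemma dc_objective_off: "x \<notin> C \<Longrightarrow> dc_objective C u v x = \<infinity>"
  by (simp add: dc_objective_def indicator_infty_def)

text \<open>
  The vector \<open>h\<close> is a subgradient of \<open>u\<close> plus the indicator of \<open>C\<close>. Its inequality cancels the part
  of the difference quotient that comes from \<open>u\<close>, and what remains is the first-order remainder of \<open>v\<close>,
  which tends to zero relative to the distance.
\<close>

lemma frechet_subdiff_dc_objective:
  fixes u v :: "'a::real_inner \<Rightarrow> real"
  assumes "x \<in> C" and u: "\<And>y. y \<in> C \<Longrightarrow> u x + h \<bullet> (y - x) \<le> u y" and v: "GDERIV v x :> g"
  shows "h - g \<in> frechet_subdiff (dc_objective C u v) x"
proof -
  let ?F = "dc_objective C u v"
  let ?q = "\<lambda>y. (?F y - ?F x - ereal ((h - g) \<bullet> (y - x))) / ereal (norm (y - x))"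
  let ?e = "\<lambda>y. (v y - v x - g \<bullet> (y - x)) / norm (y - x)"
  have "(?e \<longlongrightarrow> 0) (at x)"
    using v unfolding gderiv_def has_derivative_at2
    by (auto simp: inner_commute divide_inverse mult.commute diff_diff_eq)
  then have "((\<lambda>y. - ?e y) \<longlongrightarrow> 0) (at x)"
    using tendsto_minus by force
  then have lim: "((\<lambda>y. ereal (- ?e y)) \<longlongrightarrow> 0) (at x)"
    by (simp add: zero_ereal_def)
  have "ereal (- ?e y) \<le> ?q y" if "y \<noteq> x" for y
  proof (cases "y \<in> C")
    case True
    have "- (v y - v x - g \<bullet> (y - x)) \<le> (u y - v y) - (u x - v x) - (h - g) \<bullet> (y - x)"
      using u[OF True] by (simp add: inner_diff_left)
    then have "- ?e y \<le> ((u y - v y) - (u x - v x) - (h - g) \<bullet> (y - x)) / norm (y - x)"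
      by (metis divide_minus_left divide_right_mono norm_ge_zero)
    then show ?thesis
      using that True \<open>x \<in> C\<close> by (simp add: dc_objective_on)
  next
    case False
    then have "?q y = \<infinity>"
      using that \<open>x \<in> C\<close> by (simp add: dc_objective_on dc_objective_off)
    then show ?thesis
      by simp
  qed
  then have "Liminf (at x) (\<lambda>y. ereal (- ?e y)) \<le> Liminf (at x) ?q"
    by (intro Liminf_mono) (auto simp: eventually_at_filter)
  moreover have "0 \<le> Liminf (at x) (\<lambda>y. ereal (- ?e y))"
  \<comment> \<open>In the zero-dimensional space there is no punctured neighbourhood and the limit inferior is infinite.\<close>
  proof (cases "trivial_limit (at x)")
    case True
    then show ?thesis by (simp add: le_Liminf_iff)
  next
    case False
    then show ?thesis using lim_imp_Liminf[OF False lim] by simp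
  qed
  ultimately have "0 \<le> Liminf (at x) ?q"
    by order
  then show ?thesis
    using \<open>x \<in> C\<close> by (simp add: frechet_subdiff_def eff_dom_def dc_objective_on)
qed

lemma frechet_subdiff_subset_limiting: "frechet_subdiff F x \<subseteq> limiting_subdiff F x"
  unfolding limiting_subdiff_def by (auto intro!: exI[of _ "\<lambda>_. x"] exI[of _ "\<lambda>_. _"])

section \<open>Finite length from the Kurdyka-Lojasiewicz inequality\<close>

text \<open>
  The point \<open>s = 0\<close> is included although \<open>\<phi>\<close> may fail to be differentiable there. It is needed when a
  single step of the algorithm reaches the limiting value.
\<close>

lemma desingularizing_tangent:
  assumes \<phi>: "desingularizing \<eta> \<phi>" and t: "0 < t" "ereal t < \<eta>" and s: "0 \<le> s" "ereal s < \<eta>"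
  shows "deriv \<phi> t * (t - s) \<le> \<phi> t - \<phi> s"
proof -
  define I where "I = {t. 0 \<le> t \<and> ereal t < \<eta>}"
  define J where "J = {t. 0 < t \<and> ereal t < \<eta>}"
  have conc: "convex_on I (\<lambda>t. - \<phi> t)" and diff: "\<phi> differentiable (at t)"
    using \<phi> t by (auto simp: desingularizing_def Let_def concave_on_def I_def)
  have "J = {0<..} \<inter> ereal -` {..<\<eta>}"
    by (auto simp: J_def)
  moreover have "open (ereal -` {..<\<eta>})"
    by (rule open_ereal_vimage) simp
  ultimately have "open J"
    by (simp add: open_Int)
  then have "t \<in> interior I"
    using t by (auto simp: I_def J_def intro!: interiorI[of J])
  have "(\<phi> has_field_derivative deriv \<phi> t) (at t)"
    using diff by (simp add: DERIV_deriv_iff_real_differentiable)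
  then have "((\<lambda>t. - \<phi> t) has_field_derivative - deriv \<phi> t) (at t within I)"
    by (rule DERIV_minus[OF has_field_derivative_at_within])
  moreover have "connected I"
    using conc by (intro convex_connected convex_on_imp_convex)
  moreover have "s \<in> I"
    using s by (simp add: I_def)
  ultimately have "- deriv \<phi> t * (s - t) \<le> - \<phi> s - (- \<phi> t)"
    using convex_on_imp_above_tangent[OF conc _ \<open>t \<in> interior I\<close>] by blast
  then show ?thesis
    by (simp add: right_diff_distrib)
qed

text \<open>
  Multiplying the decrease by the derivative of \<open>\<phi>\<close> and using concavity bounds the square of the new
  step by the old step times \<open>m = L/\<sigma> (\<phi> r1 - \<phi> r2)\<close>. The arithmetic-geometric mean inequality then gives
  \<open>2 dist x2 x1 \<le> dist x1 x0 + m\<close>, which is the claim rearranged so that it telescopes.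
\<close>

lemma KL_energy_step:
  assumes \<phi>: "desingularizing \<eta> \<phi>" and pos: "0 < \<sigma>" "0 < L"
    and r: "0 \<le> r1" "0 \<le> r2" "ereal r1 < \<eta>"
    and descent: "\<sigma> * (dist x2 x1)\<^sup>2 \<le> r1 - r2"
    and KL: "0 < r1 \<Longrightarrow> 1 \<le> deriv \<phi> r1 * (L * dist x1 x0)"
  shows "dist x2 x1 + (dist x2 x1 + L / \<sigma> * \<phi> r2) \<le> dist x1 x0 + L / \<sigma> * \<phi> r1"
proof (cases "r1 = 0")
  case True
  have "0 \<le> \<sigma> * (dist x2 x1)\<^sup>2"
    using pos by simp
  then have "r2 = 0" "\<sigma> * (dist x2 x1)\<^sup>2 = 0"
    using descent r True by linarith+
  then show ?thesis
    using True pos by simp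
next
  case False
  then have "0 < r1"
    using r by simp
  have "0 \<le> \<sigma> * (dist x2 x1)\<^sup>2"
    using pos by simp
  then have "r2 \<le> r1"
    using descent by linarith
  then have "ereal r2 < \<eta>"
    using r by (metis ereal_less_eq(3) order_le_less_trans)
  let ?p = "deriv \<phi> r1" and ?m = "L / \<sigma> * (\<phi> r1 - \<phi> r2)"
  have "0 < ?p"
    using \<phi> \<open>0 < r1\<close> r by (auto simp: desingularizing_def Let_def)
  have "?p * (\<sigma> * (dist x2 x1)\<^sup>2) \<le> ?p * (r1 - r2)"
    using descent \<open>0 < ?p\<close> by simp
  also have "\<dots> \<le> \<phi> r1 - \<phi> r2"
    using desingularizing_tangent[OF \<phi> \<open>0 < r1\<close> r(3) r(2) \<open>ereal r2 < \<eta>\<close>] .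
  finally have gap: "?p * (\<sigma> * (dist x2 x1)\<^sup>2) \<le> \<phi> r1 - \<phi> r2" .
  have "\<sigma> * (dist x2 x1)\<^sup>2 * 1 \<le> \<sigma> * (dist x2 x1)\<^sup>2 * (?p * (L * dist x1 x0))"
    using KL[OF \<open>0 < r1\<close>] pos by (intro mult_left_mono) auto
  also have "\<dots> = ?p * (\<sigma> * (dist x2 x1)\<^sup>2) * (L * dist x1 x0)"
    by simp
  also have "\<dots> \<le> (\<phi> r1 - \<phi> r2) * (L * dist x1 x0)"
    using gap pos by (intro mult_right_mono) auto
  finally have "(dist x2 x1)\<^sup>2 \<le> dist x1 x0 * ?m"
    using pos by (simp add: field_simps)
  moreover have "4 * (a * b) \<le> (a + b)\<^sup>2" for a b :: real
    using zero_le_power2[of "a - b"] unfolding power2_sum power2_diff by linarith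
  from this[of "dist x1 x0" ?m] have "4 * (dist x1 x0 * ?m) \<le> (dist x1 x0 + ?m)\<^sup>2" .
  ultimately have square: "(2 * dist x2 x1)\<^sup>2 \<le> (dist x1 x0 + ?m)\<^sup>2"
    by simp
  have "0 \<le> ?p * (\<sigma> * (dist x2 x1)\<^sup>2)"
    using \<open>0 < ?p\<close> pos by simp
  then have "0 \<le> ?m"
    using gap pos by simp
  then have "0 \<le> dist x1 x0 + ?m"
    by (rule add_nonneg_nonneg[OF zero_le_dist])
  with square have "2 * dist x2 x1 \<le> dist x1 x0 + ?m"
    by (rule power2_le_imp_le)
  then show ?thesis
    by (simp only: right_diff_distrib)
qed

lemma descent_steps_vanish:
  fixes x :: "nat \<Rightarrow> 'a::metric_space"
  assumes "0 < \<sigma>" and descent: "\<And>k. \<sigma> * (dist (x (Suc k)) (x k))\<^sup>2 \<le> r k - r (Suc k)"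
    and r: "r \<longlonglongrightarrow> l"
  shows "(\<lambda>k. dist (x (Suc k)) (x k)) \<longlonglongrightarrow> 0"
proof -
  have drop_0: "(\<lambda>k. (r k - r (Suc k)) / \<sigma>) \<longlonglongrightarrow> 0"
    using tendsto_divide[OF tendsto_diff[OF r LIMSEQ_Suc[OF r]] tendsto_const, of \<sigma>] \<open>0 < \<sigma>\<close>
    by simp
  have "\<forall>k. norm ((dist (x (Suc k)) (x k))\<^sup>2) \<le> (r k - r (Suc k)) / \<sigma>"
    using descent \<open>0 < \<sigma>\<close> by (simp add: field_simps)
  then have "(\<lambda>k. (dist (x (Suc k)) (x k))\<^sup>2) \<longlonglongrightarrow> 0"
    by (intro Lim_null_comparison[OF _ drop_0] always_eventually)
  then show ?thesis
    using tendsto_real_sqrt by fastforce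
qed

text \<open>
  The inequality is available only inside \<open>U\<close>. Because of the cluster point, some iterate lies within
  half the radius of a ball in \<open>U\<close> at a time when the energy is below the other half. From then on, the
  distance travelled is paid for by the energy, so the iterates remain in the ball, and the telescoping
  estimate holds for all later steps.
\<close>

lemma KL_finite_length:
  fixes x :: "nat \<Rightarrow> 'a::metric_space"
  assumes \<phi>: "desingularizing \<eta> \<phi>" and pos: "0 < \<sigma>" "0 < L" "0 < \<eta>"
    and U: "open U" "z \<in> U"
    and r: "\<And>k. 0 \<le> r k" "r \<longlonglongrightarrow> 0"
    and descent: "\<And>k. \<sigma> * (dist (x (Suc k)) (x k))\<^sup>2 \<le> r k - r (Suc k)"
    and KL: "\<And>k. x (Suc k) \<in> U \<Longrightarrow> 0 < r (Suc k) \<Longrightarrow> ereal (r (Suc k)) < \<eta>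
      \<Longrightarrow> 1 \<le> deriv \<phi> (r (Suc k)) * (L * dist (x (Suc k)) (x k))"
    and cluster: "strict_mono s" "(\<lambda>j. x (s j)) \<longlonglongrightarrow> z"
  shows "summable (\<lambda>k. dist (x (Suc k)) (x k))"
    and "x \<longlonglongrightarrow> z"
    and "\<forall>\<^sub>F k in sequentially.
      dist (x (Suc k)) z \<le> dist (x (Suc k)) (x k) + L / \<sigma> * \<phi> (r (Suc k))"
proof -
  define E where "E k = dist (x (Suc k)) (x k) + L / \<sigma> * \<phi> (r (Suc k))" for k
  have r_Suc: "(\<lambda>k. r (Suc k)) \<longlonglongrightarrow> 0"
    using r(2) by (simp add: LIMSEQ_Suc)
  then have small: "\<forall>\<^sub>F k in sequentially. ereal (r (Suc k)) < \<eta>"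
    using pos(3) by (intro order_tendstoD(2)) (auto simp: zero_ereal_def)
  have step_0: "(\<lambda>k. dist (x (Suc k)) (x k)) \<longlonglongrightarrow> 0"
    using descent_steps_vanish[OF pos(1) descent r(2)] .
  have "continuous_on {t. 0 \<le> t \<and> ereal t < \<eta>} \<phi>" "\<phi> 0 = 0"
    using \<phi> by (auto simp: desingularizing_def Let_def)
  then have "(\<lambda>k. \<phi> (r (Suc k))) \<longlonglongrightarrow> 0"
    using continuous_on_tendsto_compose[OF _ r_Suc, of _ \<phi>] r(1) small pos(3)
    by (auto simp: zero_ereal_def elim!: eventually_mono)
  then have E_0: "E \<longlonglongrightarrow> 0"
    unfolding E_def by (intro tendsto_add_zero step_0 tendsto_mult_right_zero)
  obtain \<rho> where \<rho>: "0 < \<rho>" "ball z \<rho> \<subseteq> U"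
    using U by (meson openE)
  have "\<forall>\<^sub>F k in sequentially. E k < \<rho> / 2 \<and> ereal (r (Suc k)) < \<eta>"
    using order_tendstoD(2)[OF E_0, of "\<rho> / 2"] small \<rho> by (simp add: eventually_conj_iff)
  then obtain N where N: "E k < \<rho> / 2" "ereal (r (Suc k)) < \<eta>" if "N \<le> k" for k
    by (auto simp: eventually_sequentially)
  have "\<forall>\<^sub>F j in sequentially. dist (x (s j)) z < \<rho> / 2 \<and> Suc N \<le> j"
    using tendstoD[OF cluster(2), of "\<rho> / 2"] \<rho> by (simp add: eventually_conj_iff eventually_ge_at_top)
  then obtain j where j: "dist (x (s j)) z < \<rho> / 2" "Suc N \<le> j"
    by (auto simp: eventually_sequentially)
  moreover have "j \<le> s j"
    using cluster(1) by (rule seq_suble)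
  ultimately obtain K where K: "s j = Suc K" "N \<le> K"
    by (cases "s j") auto
  have E_pos: "0 \<le> E k" if "N \<le> k" for k
    using \<phi> N(2)[OF that] r(1) pos by (simp add: E_def desingularizing_def Let_def)
  have step: "dist (x (Suc (Suc k))) (x (Suc k)) + E (Suc k) \<le> E k"
    if "N \<le> k" "x (Suc k) \<in> U" for k
    unfolding E_def using KL[OF that(2)] N(2)[OF that(1)]
    by (intro KL_energy_step[OF \<phi> pos(1,2) r(1) r(1) _ descent]) auto
  \<comment> \<open>The distance travelled since step \<open>K\<close> and the remaining energy together never exceed \<open>E K\<close>.\<close>
  have trapped: "dist (x (Suc (K + i))) (x (Suc K)) + E (K + i) \<le> E K \<and> x (Suc (K + i)) \<in> U" for i
  proof (induction i)
    case 0
    have "dist z (x (Suc K)) < \<rho>"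
      using j(1) \<rho>(1) K(1) by (simp add: dist_commute)
    then show ?case
      using \<rho>(2) by auto
  next
    case (Suc i)
    have "dist (x (Suc (K + Suc i))) (x (Suc K))
        \<le> dist (x (Suc (Suc (K + i)))) (x (Suc (K + i))) + dist (x (Suc (K + i))) (x (Suc K))"
      by (simp add: dist_triangle)
    then have *: "dist (x (Suc (K + Suc i))) (x (Suc K)) + E (K + Suc i) \<le> E K"
      using step[of "K + i"] Suc K(2) by simp
    have "dist z (x (Suc (K + Suc i)))
        \<le> dist (x (Suc K)) z + dist (x (Suc (K + Suc i))) (x (Suc K))"
      by (metis add.commute dist_commute dist_triangle)
    also have "\<dots> < \<rho>"
      using * j(1) K E_pos[of "K + Suc i"] N(1)[of K] by simp
    finally show ?case
      using * \<rho>(2) by auto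
  qed
  have step': "dist (x (Suc (Suc k))) (x (Suc k)) \<le> E k - E (Suc k)" if "K \<le> k" for k
    using step[of k] trapped[of "k - K"] that K(2) by simp
  have "(\<Sum>i<n. dist (x (Suc (i + Suc K))) (x (i + Suc K))) \<le> E K - E (K + n)" for n
  proof (induction n)
    case (Suc n)
    then show ?case using step'[of "K + n"] by (simp add: add.commute)
  qed simp
  then have "(\<Sum>i<n. dist (x (Suc (i + Suc K))) (x (i + Suc K))) \<le> E K" for n
    using E_pos[of "K + n"] K(2) by (smt (verit) le_add1 le_trans)
  then have "summable (\<lambda>i. dist (x (Suc (i + Suc K))) (x (i + Suc K)))"
    by (intro summableI_nonneg_bounded) auto
  then show "summable (\<lambda>k. dist (x (Suc k)) (x k))"
    by (subst (asm) summable_iff_shift)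
  have tail: "dist (x (Suc l)) (x (Suc k)) \<le> E k - E l" if "K \<le> k" "k \<le> l" for k l
    using that(2)
  proof (induction l rule: dec_induct)
    case (step l)
    have "dist (x (Suc (Suc l))) (x (Suc k))
        \<le> dist (x (Suc (Suc l))) (x (Suc l)) + dist (x (Suc l)) (x (Suc k))"
      by (rule dist_triangle)
    then show ?case
      using step step'[of l] that(1) by simp
  qed simp
  \<comment> \<open>Along the subsequence the far end of the tail estimate tends to the cluster point.\<close>
  have lim: "dist (x (Suc k)) z \<le> E k" if "K \<le> k" for k
  proof (rule LIMSEQ_le_const2)
    show "(\<lambda>j. dist (x (Suc k)) (x (s j))) \<longlonglongrightarrow> dist (x (Suc k)) z"
      by (intro tendsto_intros cluster)
    have "dist (x (Suc k)) (x (s j)) \<le> E k" if "Suc k \<le> j" for j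
    proof -
      have "Suc k \<le> s j"
        using seq_suble[OF cluster(1), of j] that by simp
      then obtain l where l: "s j = Suc l" "k \<le> l"
        by (cases "s j") auto
      then show ?thesis
        using tail[of k l] E_pos[of l] \<open>K \<le> k\<close> K(2) by (simp add: dist_commute)
    qed
    then show "\<exists>N. \<forall>j\<ge>N. dist (x (Suc k)) (x (s j)) \<le> E k"
      by blast
  qed
  then show "\<forall>\<^sub>F k in sequentially.
      dist (x (Suc k)) z \<le> dist (x (Suc k)) (x k) + L / \<sigma> * \<phi> (r (Suc k))"
    unfolding eventually_sequentially E_def by blast
  have "(\<lambda>k. dist (x (Suc k)) z) \<longlonglongrightarrow> 0"
    using lim by (intro Lim_null_comparison[OF _ E_0]) (auto simp: eventually_sequentially)
  then have "(\<lambda>k. x (Suc k)) \<longlonglongrightarrow> z"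
    by (subst tendsto_dist_iff)
  then show "x \<longlonglongrightarrow> z"
    by (simp add: filterlim_sequentially_Suc)
qed

section \<open>Rates of decay from recursive inequalities\<close>

lemma geometric_decay:
  fixes r :: "nat \<Rightarrow> real"
  assumes q: "0 < q" and step: "\<And>k. K \<le> k \<Longrightarrow> r (Suc k) \<le> q * r k" and r: "\<And>k. 0 \<le> r k"
  shows "\<exists>B>0. \<forall>k\<ge>K. r k \<le> B * q ^ k"
proof (intro exI conjI allI impI)
  let ?B = "r K / q ^ K + 1"
  show "0 < ?B"
    using q r[of K] by (simp add: add_nonneg_pos)
  fix k
  assume "K \<le> k"
  then have "r k \<le> r K / q ^ K * q ^ k"
  proof (induction k rule: dec_induct)
    case base
    then show ?case using q by simp
  next
    case (step k)
    have "r (Suc k) \<le> q * r k"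
      using assms(2) step.hyps by simp
    also have "\<dots> \<le> q * (r K / q ^ K * q ^ k)"
      using step.IH q by (intro mult_left_mono) auto
    finally show ?case
      by (simp add: mult_ac)
  qed
  also have "\<dots> \<le> ?B * q ^ k"
    using q by (intro mult_right_mono) auto
  finally show "r k \<le> ?B * q ^ k" .
qed

text \<open>
  The recursion is a discrete form of the differential inequality \<open>dr/dt \<le> - r^\<alpha> / A\<close>, along which
  \<open>r^(1-\<alpha>)\<close> grows at a constant rate. If \<open>r\<close> at most halves, the mean value theorem gives that growth;
  if it more than halves, the potential is multiplied by at least \<open>2^(\<alpha>-1)\<close>, and the initial bound \<open>R\<close>
  turns this factor into an additive gain.
\<close>

lemma powr_potential_gain:
  fixes \<alpha> A R r r' :: real
  assumes \<alpha>: "1 < \<alpha>" and A: "0 < A" and r: "0 < r'" "r' \<le> r" "r \<le> R"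
    and step: "r' powr \<alpha> \<le> A * (r - r')"
  shows "r powr (1 - \<alpha>) + min ((\<alpha> - 1) / (A * 2 powr \<alpha>)) ((2 powr (\<alpha> - 1) - 1) * R powr (1 - \<alpha>))
    \<le> r' powr (1 - \<alpha>)"
proof (cases "r \<le> 2 * r'")
  case True
  have "(\<alpha> - 1) * r powr (- \<alpha>) * (r - r') \<le> r' powr (1 - \<alpha>) - r powr (1 - \<alpha>)"
  proof (cases "r' = r")
    case False
    then have "r' < r"
      using r by simp
    have "\<exists>z>r'. z < r \<and> r powr (1 - \<alpha>) - r' powr (1 - \<alpha>) = (r - r') * ((1 - \<alpha>) * z powr (1 - \<alpha> - 1))"
      using \<open>r' < r\<close> r by (intro MVT2) (auto intro!: derivative_eq_intros)
    then obtain z where z: "r' < z" "z < r"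
      "r powr (1 - \<alpha>) - r' powr (1 - \<alpha>) = (r - r') * ((1 - \<alpha>) * z powr (- \<alpha>))"
      by auto
    have "r powr (- \<alpha>) \<le> z powr (- \<alpha>)"
      using z r \<alpha> by (intro powr_mono2') auto
    then have "(r - r') * ((\<alpha> - 1) * r powr (- \<alpha>)) \<le> (r - r') * ((\<alpha> - 1) * z powr (- \<alpha>))"
      using r \<alpha> by (intro mult_left_mono) auto
    then show ?thesis
      using z(3) by (simp add: algebra_simps)
  qed simp
  moreover have "(\<alpha> - 1) / (A * 2 powr \<alpha>) \<le> (\<alpha> - 1) * r powr (- \<alpha>) * (r - r')"
  proof -
    have "r powr \<alpha> \<le> (2 * r') powr \<alpha>"
      using True r \<alpha> by (intro powr_mono2) auto
    also have "\<dots> = 2 powr \<alpha> * r' powr \<alpha>"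
      using r by (simp add: powr_mult)
    also have "\<dots> \<le> 2 powr \<alpha> * (A * (r - r'))"
      using step by (intro mult_left_mono) auto
    finally have "1 \<le> A * 2 powr \<alpha> * (r powr (- \<alpha>) * (r - r'))"
      using r by (simp add: powr_minus field_simps)
    then have "1 / (A * 2 powr \<alpha>) \<le> r powr (- \<alpha>) * (r - r')"
      using A by (simp add: field_simps)
    then have "(\<alpha> - 1) * (1 / (A * 2 powr \<alpha>)) \<le> (\<alpha> - 1) * (r powr (- \<alpha>) * (r - r'))"
      using \<alpha> by (intro mult_left_mono) auto
    then show ?thesis
      by (simp add: mult.assoc)
  qed
  ultimately show ?thesis
    by (simp add: min_def)
next
  case False
  have "2 powr (\<alpha> - 1) * R powr (1 - \<alpha>) - R powr (1 - \<alpha>) = (2 powr (\<alpha> - 1) - 1) * R powr (1 - \<alpha>)"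
    by (simp add: algebra_simps)
  also have "\<dots> \<le> (2 powr (\<alpha> - 1) - 1) * r powr (1 - \<alpha>)"
  proof (rule mult_left_mono)
    show "R powr (1 - \<alpha>) \<le> r powr (1 - \<alpha>)"
      using r \<alpha> by (intro powr_mono2') auto
    show "0 \<le> 2 powr (\<alpha> - 1) - (1::real)"
      using \<alpha> ge_one_powr_ge_zero[of 2 "\<alpha> - 1"] by simp
  qed
  also have "\<dots> = (r / 2) powr (1 - \<alpha>) - r powr (1 - \<alpha>)"
    using r powr_minus[of 2 "1 - \<alpha>"] by (simp add: powr_divide field_simps)
  also have "(r / 2) powr (1 - \<alpha>) \<le> r' powr (1 - \<alpha>)"
    using False r \<alpha> by (intro powr_mono2') auto
  finally show ?thesis
    by (simp add: min_def algebra_simps)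
qed

text \<open>
  By the constant gain, \<open>r(k)^(1-\<alpha>)\<close> grows at least linearly as long as \<open>r(k)\<close> is positive; inverting
  the power gives the bound.
\<close>

lemma polynomial_decay:
  fixes r :: "nat \<Rightarrow> real"
  assumes \<alpha>: "1 < \<alpha>" and A: "0 < A" and r: "\<And>k. 0 \<le> r k" "decseq r"
    and step: "\<And>k. K \<le> k \<Longrightarrow> r (Suc k) powr \<alpha> \<le> A * (r k - r (Suc k))"
  shows "\<exists>B>0. \<exists>N>0. \<forall>k\<ge>N. r k \<le> B * real k powr (- 1 / (\<alpha> - 1))"
proof (cases "r K = 0")
  case True
  have "r k \<le> 1 * real k powr (- 1 / (\<alpha> - 1))" if "Suc K \<le> k" for k
    using r(1)[of k] decseqD[OF r(2), of K k] True that by (simp add: antisym)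
  then show ?thesis
    by (intro exI[of _ 1] conjI exI[of _ "Suc K"]) auto
next
  case False
  then have "0 < r K"
    using r(1)[of K] by simp
  define \<mu> where "\<mu> = min ((\<alpha> - 1) / (A * 2 powr \<alpha>)) ((2 powr (\<alpha> - 1) - 1) * r K powr (1 - \<alpha>))"
  have "1 < 2 powr (\<alpha> - 1)"
    using \<alpha> by (intro gr_one_powr) auto
  then have "0 < \<mu>"
    using \<alpha> A \<open>0 < r K\<close> by (simp add: \<mu>_def)
  have potential: "\<mu> * real j \<le> r (K + j) powr (1 - \<alpha>)" if "0 < r (K + j)" for j
    using that
  proof (induction j)
    case (Suc j)
    have le: "r (K + Suc j) \<le> r (K + j)" "r (K + j) \<le> r K"
      using decseqD[OF r(2)] by simp_all
    have "r (K + j) powr (1 - \<alpha>) + \<mu> \<le> r (K + Suc j) powr (1 - \<alpha>)"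
      unfolding \<mu>_def using step[of "K + j"] Suc.prems le
      by (intro powr_potential_gain[OF \<alpha> A]) auto
    then show ?case
      using Suc.IH Suc.prems le by (simp add: algebra_simps)
  qed simp
  let ?p = "1 / (\<alpha> - 1)"
  \<comment> \<open>Past \<open>2 * K\<close> at least half of all steps have contributed to the potential.\<close>
  have "r k \<le> (\<mu> / 2) powr (- ?p) * real k powr (- 1 / (\<alpha> - 1))" if k: "Suc (2 * K) \<le> k" for k
  proof (cases "r k = 0")
    case False
    then have "0 < r k"
      using r(1)[of k] by simp
    have "\<mu> / 2 * real k \<le> \<mu> * real (k - K)"
      using k \<open>0 < \<mu>\<close> by (simp add: of_nat_diff field_simps)
    also have "\<dots> \<le> r k powr (1 - \<alpha>)"
      using potential[of "k - K"] \<open>0 < r k\<close> k by simp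
    finally have "(r k powr (1 - \<alpha>)) powr (- ?p) \<le> (\<mu> / 2 * real k) powr (- ?p)"
      using \<open>0 < \<mu>\<close> k \<alpha> by (intro powr_mono2') auto
    moreover have "(r k powr (1 - \<alpha>)) powr (- ?p) = r k"
    proof -
      have "(1 - \<alpha>) * - ?p = 1"
        using \<alpha> by (simp add: field_simps)
      then show ?thesis
        using \<open>0 < r k\<close> by (simp only: powr_powr powr_one)
    qed
    moreover have "(\<mu> / 2 * real k) powr (- ?p) = (\<mu> / 2) powr (- ?p) * real k powr (- ?p)"
      by (rule powr_mult)
    ultimately show ?thesis
      by simp
  qed simp
  then show ?thesis
    using \<open>0 < \<mu>\<close> by (intro exI[of _ "(\<mu> / 2) powr (- ?p)"] conjI exI[of _ "Suc (2 * K)"]) auto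
qed

text \<open>
  Here \<open>r\<close> stands for the gap of the objective values and \<open>d\<close> for the distance of the iterates to their
  limit. For \<open>\<theta> = 0\<close> the left-hand side of the recursion is \<open>1\<close> as long as the gap is positive, while the
  right-hand side tends to \<open>0\<close>. For \<open>\<theta> \<le> 1/2\<close> a gap below \<open>1\<close> satisfies \<open>r \<le> r^(2\<theta>)\<close>, so the recursion
  is a contraction. For \<open>\<theta> > 1/2\<close> the exponent \<open>2\<theta>\<close> exceeds \<open>1\<close> and the decay is polynomial.
\<close>

lemma rates_from_KL_recursion:
  fixes r d :: "nat \<Rightarrow> real"
  assumes r: "\<And>k. 0 \<le> r k" "decseq r" "r \<longlonglongrightarrow> 0" and pos: "0 < A" "0 < D" and \<theta>: "0 \<le> \<theta>" "\<theta> < 1"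
    and rec: "\<forall>\<^sub>F k in sequentially. r (Suc k) powr (2 * \<theta>) \<le> A * (r k - r (Suc k))"
    and d: "\<forall>\<^sub>F k in sequentially. d k \<le> D * r k powr (min (1 / 2) (1 - \<theta>))"
  shows "\<theta> = 0 \<Longrightarrow> \<forall>\<^sub>F k in sequentially. d k \<le> 0"
    and "0 < \<theta> \<Longrightarrow> \<theta> \<le> 1 / 2 \<Longrightarrow>
      \<exists>B>0. \<exists>\<rho>. 0 < \<rho> \<and> \<rho> < 1 \<and> (\<forall>\<^sub>F k in sequentially. d k \<le> B * \<rho> ^ k)"
    and "1 / 2 < \<theta> \<Longrightarrow>
      \<exists>B>0. \<forall>\<^sub>F k in sequentially. d k \<le> B * real k powr (- (1 - \<theta>) / (2 * \<theta> - 1))"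
proof -
  have r_Suc: "(\<lambda>k. r (Suc k)) \<longlonglongrightarrow> 0"
    using r(3) by (simp add: LIMSEQ_Suc)
  obtain K where K: "r (Suc k) powr (2 * \<theta>) \<le> A * (r k - r (Suc k))" if "K \<le> k" for k
    using rec by (auto simp: eventually_sequentially)
  {
    assume "\<theta> = 0"
    have "(\<lambda>k. A * (r k - r (Suc k))) \<longlonglongrightarrow> 0"
      using tendsto_mult[OF tendsto_const tendsto_diff[OF r(3) r_Suc], of A] by simp
    then have "\<forall>\<^sub>F k in sequentially. A * (r k - r (Suc k)) < 1"
      by (rule order_tendstoD) simp
    with rec have "\<forall>\<^sub>F k in sequentially. r (Suc k) = 0"
    proof eventually_elim
      case (elim k)
      then show ?case
        using \<open>\<theta> = 0\<close> by (cases "r (Suc k) = 0") auto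
    qed
    then have "\<forall>\<^sub>F k in sequentially. r k = 0"
      by (rule eventually_sequentially_Suc[THEN iffD1])
    with d show "\<forall>\<^sub>F k in sequentially. d k \<le> 0"
      by eventually_elim simp
  next
    assume "0 < \<theta>" "\<theta> \<le> 1 / 2"
    have "\<forall>\<^sub>F k in sequentially. r (Suc k) < 1"
      using r_Suc by (rule order_tendstoD) simp
    with rec have "\<forall>\<^sub>F k in sequentially. r (Suc k) \<le> A / (1 + A) * r k"
    proof eventually_elim
      case (elim k)
      have "r (Suc k) = r (Suc k) powr 1"
        using r(1) by simp
      also have "\<dots> \<le> r (Suc k) powr (2 * \<theta>)"
        using \<open>\<theta> \<le> 1 / 2\<close> elim r(1) by (intro powr_mono') auto
      finally show ?case
        using elim(1) pos by (simp add: field_simps)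
    qed
    then obtain N where "r (Suc k) \<le> A / (1 + A) * r k" if "N \<le> k" for k
      by (auto simp: eventually_sequentially)
    then obtain B where B: "0 < B" "\<And>k. N \<le> k \<Longrightarrow> r k \<le> B * (A / (1 + A)) ^ k"
      using geometric_decay[of "A / (1 + A)" N r] r(1) pos by auto
    show "\<exists>B>0. \<exists>\<rho>. 0 < \<rho> \<and> \<rho> < 1 \<and> (\<forall>\<^sub>F k in sequentially. d k \<le> B * \<rho> ^ k)"
    proof (intro exI conjI)
      show "0 < D * sqrt B" "0 < sqrt (A / (1 + A))" "sqrt (A / (1 + A)) < 1"
        using pos B by auto
      from d eventually_ge_at_top[of N]
      show "\<forall>\<^sub>F k in sequentially. d k \<le> D * sqrt B * sqrt (A / (1 + A)) ^ k"
      proof eventually_elim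
        case (elim k)
        have "r k powr (min (1 / 2) (1 - \<theta>)) = sqrt (r k)"
          using \<open>\<theta> \<le> 1 / 2\<close> r(1) by (simp add: min_def powr_half_sqrt)
        also have "\<dots> \<le> sqrt (B * (A / (1 + A)) ^ k)"
          using B(2) elim by simp
        also have "\<dots> = sqrt B * sqrt (A / (1 + A)) ^ k"
          by (simp add: real_sqrt_mult real_sqrt_power)
        finally have "D * r k powr (min (1 / 2) (1 - \<theta>)) \<le> D * (sqrt B * sqrt (A / (1 + A)) ^ k)"
          using pos by (intro mult_left_mono) auto
        then show ?case
          using elim by (simp add: mult.assoc)
      qed
    qed
  next
    assume \<theta>_half: "1 / 2 < \<theta>"
    then obtain B N where B: "0 < B"
      "\<And>k. N \<le> k \<Longrightarrow> r k \<le> B * real k powr (- 1 / (2 * \<theta> - 1))"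
      using polynomial_decay[of "2 * \<theta>" A r K] r(1,2) pos K by auto
    show "\<exists>B>0. \<forall>\<^sub>F k in sequentially. d k \<le> B * real k powr (- (1 - \<theta>) / (2 * \<theta> - 1))"
    proof (intro exI conjI)
      show "0 < D * B powr (1 - \<theta>)"
        using pos B by auto
      from d eventually_ge_at_top[of N]
      show "\<forall>\<^sub>F k in sequentially. d k \<le>
        D * B powr (1 - \<theta>) * real k powr (- (1 - \<theta>) / (2 * \<theta> - 1))"
      proof eventually_elim
        case (elim k)
        have "r k powr (min (1 / 2) (1 - \<theta>)) = r k powr (1 - \<theta>)"
          using \<theta>_half by (simp add: min_def)
        also have "\<dots> \<le> (B * real k powr (- 1 / (2 * \<theta> - 1))) powr (1 - \<theta>)"
          using B(2) elim r(1) \<theta> by (intro powr_mono2) auto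
        also have "\<dots> = B powr (1 - \<theta>) * real k powr (- (1 - \<theta>) / (2 * \<theta> - 1))"
          by (simp only: powr_mult powr_powr times_divide_eq_left mult_minus1)
        finally have "D * r k powr (min (1 / 2) (1 - \<theta>))
            \<le> D * (B powr (1 - \<theta>) * real k powr (- (1 - \<theta>) / (2 * \<theta> - 1)))"
          using pos by (intro mult_left_mono) auto
        then show ?case
          using elim by (simp add: mult.assoc)
      qed
    qed
  }
qed

lemma geometric_bound_shift:
  fixes d :: "nat \<Rightarrow> real"
  assumes "0 < B" "0 < \<rho>" and bound: "\<forall>\<^sub>F k in sequentially. d (Suc (Suc k)) \<le> B * \<rho> ^ k"
  shows "\<exists>K>0. \<exists>B>0. \<forall>k\<ge>K. d k \<le> B * \<rho> ^ k"
proof -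
  obtain N where N: "\<And>k. N \<le> k \<Longrightarrow> d (Suc (Suc k)) \<le> B * \<rho> ^ k"
    using bound by (auto simp: eventually_sequentially)
  have "d k \<le> B / \<rho>\<^sup>2 * \<rho> ^ k" if k: "Suc (Suc N) \<le> k" for k
  proof -
    obtain j where "k = Suc (Suc j)" "N \<le> j"
      using k by (intro that[of "k - 2"]) auto
    then show ?thesis
      using N[of j] \<open>0 < \<rho>\<close> by (simp add: power2_eq_square)
  qed
  moreover have "0 < B / \<rho>\<^sup>2"
    using assms by simp
  ultimately show ?thesis
    by (intro exI[of _ "Suc (Suc N)"] conjI exI[of _ "B / \<rho>\<^sup>2"]) auto
qed

lemma polynomial_bound_shift:
  fixes d :: "nat \<Rightarrow> real"
  assumes "0 < B" "p \<le> 0" and bound: "\<forall>\<^sub>F k in sequentially. d (Suc (Suc k)) \<le> B * real k powr p"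
  shows "\<exists>K>0. \<exists>B>0. \<forall>k\<ge>K. d k \<le> B * real k powr p"
proof -
  obtain N where N: "\<And>k. N \<le> k \<Longrightarrow> d (Suc (Suc k)) \<le> B * real k powr p"
    using bound by (auto simp: eventually_sequentially)
  have "d k \<le> B * (1 / 3) powr p * real k powr p" if k: "N + 3 \<le> k" for k
  proof -
    obtain j where j: "k = Suc (Suc j)" "N \<le> j" "1 \<le> j"
      using k by (intro that[of "k - 2"]) auto
    \<comment> \<open>For \<open>j \<ge> 1\<close> the shifted index \<open>j + 2\<close> is at most \<open>3 * j\<close>.\<close>
    have "real j powr p \<le> (1 / 3 * real k) powr p"
      using j \<open>p \<le> 0\<close> by (intro powr_mono2') auto
    also have "\<dots> = (1 / 3) powr p * real k powr p"
      by (rule powr_mult)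
    finally have "B * real j powr p \<le> B * ((1 / 3) powr p * real k powr p)"
      using \<open>0 < B\<close> by (intro mult_left_mono) auto
    then show ?thesis
      using N[OF j(2)] j(1) by (simp add: mult.assoc)
  qed
  moreover have "0 < B * (1 / 3) powr p"
    using assms by simp
  ultimately show ?thesis
    by (intro exI[of _ "N + 3"] conjI exI[of _ "B * (1 / 3) powr p"]) auto
qed

section \<open>The difference-of-convex algorithm\<close>

lemma closed_feasible_set:
  fixes c d :: "nat \<Rightarrow> 'a::euclidean_space \<Rightarrow> real"
  assumes c: "\<And>i. i \<in> {1..n} \<Longrightarrow> convex_on UNIV (c i)" and d: "\<And>j. j \<in> {1..m} \<Longrightarrow> affine_fun (d j)"
  shows "closed (feasible_set n m c d)"
proof -
  have "continuous_on UNIV (c i)" if "i \<in> {1..n}" for i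
    using c[OF that] by (simp add: convex_on_continuous)
  moreover have "continuous_on UNIV (d j)" if "j \<in> {1..m}" for j
  proof -
    obtain a b where "d j = (\<lambda>x. a \<bullet> x + b)"
      using d[OF \<open>j \<in> {1..m}\<close>] by (auto simp: affine_fun_def)
    then show ?thesis
      by (auto intro!: continuous_intros)
  qed
  ultimately have "closed ((\<Inter>i\<in>{1..n}. {x. c i x \<le> 0}) \<inter> (\<Inter>j\<in>{1..m}. {x. d j x = 0}))"
    by (intro closed_Int closed_INT ballI closed_Collect_le closed_Collect_eq continuous_on_const) auto
  moreover have "feasible_set n m c d = (\<Inter>i\<in>{1..n}. {x. c i x \<le> 0}) \<inter> (\<Inter>j\<in>{1..m}. {x. d j x = 0})"
    by (auto simp: feasible_set_def)
  ultimately show ?thesis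
    by simp
qed

lemma convex_feasible_set:
  fixes c d :: "nat \<Rightarrow> 'a::real_inner \<Rightarrow> real"
  assumes c: "\<And>i. i \<in> {1..n} \<Longrightarrow> convex_on UNIV (c i)" and d: "\<And>j. j \<in> {1..m} \<Longrightarrow> affine_fun (d j)"
  shows "convex (feasible_set n m c d)"
proof (rule convexI)
  fix x y and s t :: real
  assume xy: "x \<in> feasible_set n m c d" "y \<in> feasible_set n m c d" and st: "0 \<le> s" "0 \<le> t" "s + t = 1"
  have "c i (s *\<^sub>R x + t *\<^sub>R y) \<le> 0" if i: "i \<in> {1..n}" for i
  proof -
    have "c i (s *\<^sub>R x + t *\<^sub>R y) \<le> s * c i x + t * c i y"
      using c[OF i] st by (simp add: convex_on_def)
    also have "\<dots> \<le> 0"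
      using xy i st by (intro add_nonpos_nonpos mult_nonneg_nonpos) (auto simp: feasible_set_def)
    finally show ?thesis .
  qed
  moreover have "d j (s *\<^sub>R x + t *\<^sub>R y) = 0" if j: "j \<in> {1..m}" for j
  proof -
    obtain a b where ab: "\<And>x. d j x = a \<bullet> x + b"
      using d[OF j] by (auto simp: affine_fun_def)
    have "d j (s *\<^sub>R x + t *\<^sub>R y) = s * d j x + t * d j y + (1 - (s + t)) * b"
      unfolding ab by (simp add: inner_right_distrib algebra_simps)
    then show ?thesis
      using xy j st by (simp add: feasible_set_def)
  qed
  ultimately show "s *\<^sub>R x + t *\<^sub>R y \<in> feasible_set n m c d"
    by (simp add: feasible_set_def)
qed

text \<open>
  A feasible point has a finite value, so a minimizer of the extended-valued objective is feasible.
\<close>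

lemma is_arg_min_indicator_linear:
  assumes "C \<noteq> {}"
    and min: "is_arg_min (\<lambda>x. indicator_infty C x + ereal (u x) - ereal (h \<bullet> x)) (\<lambda>_. True) x"
  shows "x \<in> C" and "y \<in> C \<Longrightarrow> u x - h \<bullet> x \<le> u y - h \<bullet> y"
proof -
  have le: "indicator_infty C x + ereal (u x) - ereal (h \<bullet> x)
      \<le> indicator_infty C y + ereal (u y) - ereal (h \<bullet> y)" for y
    using min by (simp add: is_arg_min_linorder)
  obtain y0 where "y0 \<in> C"
    using \<open>C \<noteq> {}\<close> by auto
  then show "x \<in> C"
    using le[of y0] by (auto simp: indicator_infty_def split: if_splits)
  then show "u x - h \<bullet> x \<le> u y - h \<bullet> y" if "y \<in> C"
    using le[of y] that by (simp add: indicator_infty_def)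
qed

text \<open>
  The Kurdyka-Lojasiewicz inequality on the feasible set in terms of real numbers. The distance to the
  subdifferential is replaced by the norm of any of its elements.
\<close>

lemma KL_with_dc_objective:
  fixes u v :: "'a::real_inner \<Rightarrow> real"
  defines "f \<equiv> \<lambda>x. u x - v x"
  assumes KL: "KL_with (dc_objective C u v) z \<phi>" and "z \<in> C"
  obtains \<eta> U where "0 < \<eta>" "desingularizing \<eta> \<phi>" "open U" "z \<in> U"
    "\<And>y g. y \<in> U \<Longrightarrow> y \<in> C \<Longrightarrow> g \<in> limiting_subdiff (dc_objective C u v) y \<Longrightarrow> 0 < f y - f z \<Longrightarrow>
      ereal (f y - f z) < \<eta> \<Longrightarrow> 1 \<le> deriv \<phi> (f y - f z) * norm g"
proof -
  let ?F = "dc_objective C u v"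
  obtain \<eta> U where \<eta>: "0 < \<eta>" "desingularizing \<eta> \<phi>" "open U" "z \<in> U"
    and ineq: "\<And>y. y \<in> U \<Longrightarrow> ?F z < ?F y \<Longrightarrow> ?F y < ?F z + \<eta> \<Longrightarrow>
      1 \<le> ereal (deriv \<phi> (real_of_ereal (?F y - ?F z))) * edist_set 0 (limiting_subdiff ?F y)"
    using KL unfolding KL_with_def by blast
  have "1 \<le> deriv \<phi> (f y - f z) * norm g"
    if y: "y \<in> U" "y \<in> C" and g: "g \<in> limiting_subdiff ?F y"
      and fy: "0 < f y - f z" "ereal (f y - f z) < \<eta>" for y g
  proof -
    have F: "?F y = ereal (f y)" "?F z = ereal (f z)"
      using y(2) \<open>z \<in> C\<close> by (simp_all add: dc_objective_on f_def)
    have "?F z < ?F y"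
      using fy(1) by (simp add: F)
    moreover have "?F y < ?F z + \<eta>"
      using fy(2) by (cases \<eta>) (auto simp: F)
    ultimately have "1 \<le> ereal (deriv \<phi> (f y - f z)) * edist_set 0 (limiting_subdiff ?F y)"
      using ineq[OF y(1)] by (simp add: F)
    also have "\<dots> \<le> ereal (deriv \<phi> (f y - f z)) * ereal (norm g)"
    proof (rule ereal_mult_left_mono)
      show "edist_set 0 (limiting_subdiff ?F y) \<le> ereal (norm g)"
        unfolding edist_set_def using g by (intro INF_lower2[of g]) auto
      show "0 \<le> ereal (deriv \<phi> (f y - f z))"
        using \<eta>(2) fy by (auto simp: desingularizing_def Let_def intro: less_imp_le)
    qed
    finally show ?thesis
      by (simp add: one_ereal_def)
  qed
  with \<eta> show ?thesis
    using that by blast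
qed

text \<open>
  The initial point need not be feasible, but every later iterate is. For this reason the analysis
  follows the shifted sequence \<open>x k = w (Suc k)\<close>, along which the objective has the real values \<open>f (x k)\<close>.
\<close>

locale dc_algorithm =
  fixes C :: "'a::euclidean_space set" and u v :: "'a \<Rightarrow> real" and \<gamma> L :: real and w :: "nat \<Rightarrow> 'a"
  assumes C: "closed C" "convex C"
    and u: "continuous_on UNIV u" "strongly_convex \<gamma> u" "0 < \<gamma>"
    and v: "convex_on UNIV v" "\<And>x. v differentiable (at x)"
    and L: "0 < L" "\<And>x y. norm (grad v x - grad v y) \<le> L * dist x y"
    and feasible: "\<And>k. w (Suc k) \<in> C"
    and minimal: "\<And>k y. y \<in> C \<Longrightarrow>
      u (w (Suc k)) - grad v (w k) \<bullet> w (Suc k) \<le> u y - grad v (w k) \<bullet> y"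
begin

abbreviation F :: "'a \<Rightarrow> ereal" where "F \<equiv> dc_objective C u v"

abbreviation f :: "'a \<Rightarrow> real" where "f x \<equiv> u x - v x"

abbreviation x :: "nat \<Rightarrow> 'a" where "x k \<equiv> w (Suc k)"

lemma growth:
  assumes "y \<in> C"
  shows "u (w (Suc k)) + grad v (w k) \<bullet> (y - w (Suc k)) + \<gamma> / 2 * (norm (y - w (Suc k)))\<^sup>2 \<le> u y"
  using strongly_convex_minimizer_growth[OF u(2) C(2) feasible assms minimal] .

text \<open>
  Quadratic growth of the subproblem at its minimizer, tested with the previous iterate, and convexity
  of \<open>v\<close>.
\<close>

lemma descent: "\<gamma> / 2 * (dist (x (Suc k)) (x k))\<^sup>2 \<le> f (x k) - f (x (Suc k))"
proof -
  have "v (x k) + grad v (x k) \<bullet> (x (Suc k) - x k) \<le> v (x (Suc k))"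
    using v by (intro convex_on_above_gradient GDERIV_grad) auto
  moreover have "u (x (Suc k)) + grad v (x k) \<bullet> (x k - x (Suc k))
      + \<gamma> / 2 * (norm (x k - x (Suc k)))\<^sup>2 \<le> u (x k)"
    using growth[OF feasible] .
  ultimately show ?thesis
    by (simp add: dist_norm norm_minus_commute inner_diff_right)
qed

lemma decseq_f: "decseq (\<lambda>k. f (x k))"
proof (rule decseq_SucI)
  fix k
  have "0 \<le> \<gamma> / 2 * (dist (x (Suc k)) (x k))\<^sup>2"
    using u(3) by simp
  then show "f (x (Suc k)) \<le> f (x k)"
    using descent[of k] by linarith
qed

lemma continuous_f: "continuous_on UNIV f"
  using u(1) v(1) by (intro continuous_on_diff) (auto intro: convex_on_continuous)

lemma gradient_gap_in_subdiff: "grad v (w k) - grad v (w (Suc k)) \<in> frechet_subdiff F (w (Suc k))"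
proof (rule frechet_subdiff_dc_objective[OF feasible _ GDERIV_grad[OF v(2)]])
  fix y
  assume "y \<in> C"
  then have "u (w (Suc k)) + grad v (w k) \<bullet> (y - w (Suc k)) + \<gamma> / 2 * (norm (y - w (Suc k)))\<^sup>2 \<le> u y"
    by (rule growth)
  moreover have "0 \<le> \<gamma> / 2 * (norm (y - w (Suc k)))\<^sup>2"
    using u(3) by simp
  ultimately show "u (w (Suc k)) + grad v (w k) \<bullet> (y - w (Suc k)) \<le> u y"
    by linarith
qed

text \<open>
  The gradient gaps are Frechet subgradients that tend to zero because the steps do. Together with the
  continuity of \<open>f\<close> along the subsequence they witness that zero is a limiting subgradient.
\<close>

lemma critical_cluster_point:
  assumes "coercive F"
  obtains z s where "strict_mono s" "(\<lambda>j. x (s j)) \<longlonglongrightarrow> z" "z \<in> C" "(\<lambda>k. f (x k)) \<longlonglongrightarrow> f z"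
    "critical_point F z"
proof -
  have "\<forall>\<^sub>F y in at_infinity. ereal (f (x 0)) < F y"
    using assms unfolding coercive_def by (rule order_tendstoD) simp
  then obtain b where b: "\<And>y. b \<le> norm y \<Longrightarrow> ereal (f (x 0)) < F y"
    by (auto simp: eventually_at_infinity)
  have "x k \<in> cball 0 b" for k
  proof (rule ccontr)
    assume "x k \<notin> cball 0 b"
    then have "ereal (f (x 0)) < F (x k)"
      by (intro b) simp
    then show False
      using decseqD[OF decseq_f, of 0 k] feasible by (simp add: dc_objective_on)
  qed
  then obtain z s where s: "strict_mono s" and "(x \<circ> s) \<longlonglongrightarrow> z"
    using compact_cball[of 0 b] unfolding compact_def by metis
  then have lim: "(\<lambda>j. x (s j)) \<longlonglongrightarrow> z"
    by (simp add: comp_def)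
  have "z \<in> C"
    using C(1) feasible lim by (metis closed_sequentially)
  have f_lim: "(\<lambda>j. f (x (s j))) \<longlonglongrightarrow> f z"
    using continuous_on_tendsto_compose[OF continuous_f lim] by simp
  have "f z \<le> f (x k)" for k
  proof (rule LIMSEQ_le_const2[OF f_lim])
    have "f (x (s j)) \<le> f (x k)" if "k \<le> j" for j
      using decseqD[OF decseq_f] seq_suble[OF s, of j] that by (meson le_trans)
    then show "\<exists>N. \<forall>j\<ge>N. f (x (s j)) \<le> f (x k)"
      by blast
  qed
  then obtain l where l: "(\<lambda>k. f (x k)) \<longlonglongrightarrow> l"
    using decseq_convergent[OF decseq_f] by blast
  then have "(\<lambda>j. f (x (s j))) \<longlonglongrightarrow> l"
    using LIMSEQ_subseq_LIMSEQ[OF l s] by (simp add: comp_def)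
  then have "l = f z"
    using f_lim by (rule LIMSEQ_unique)
  define g where "g k = grad v (w k) - grad v (w (Suc k))" for k
  have "(\<lambda>k. dist (x (Suc k)) (x k)) \<longlonglongrightarrow> 0"
    using u(3) by (intro descent_steps_vanish[OF _ descent l]) simp
  then have "(\<lambda>k. L * dist (w (Suc k)) (w k)) \<longlonglongrightarrow> 0"
    by (intro tendsto_mult_right_zero) (rule filterlim_sequentially_Suc[THEN iffD1])
  then have "g \<longlonglongrightarrow> 0"
    by (rule Lim_null_comparison[rotated]) (use L(2) in \<open>auto simp: g_def dist_commute\<close>)
  then have "(\<lambda>j. g (s j)) \<longlonglongrightarrow> 0"
    using LIMSEQ_subseq_LIMSEQ[OF _ s] by (auto simp: comp_def)
  moreover have "(\<lambda>j. F (x (s j))) \<longlonglongrightarrow> F z"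
    using f_lim feasible \<open>z \<in> C\<close> by (simp add: dc_objective_on)
  moreover have "\<forall>j. g (s j) \<in> frechet_subdiff F (x (s j))"
    unfolding g_def using gradient_gap_in_subdiff by blast
  ultimately have "critical_point F z"
    unfolding critical_point_def limiting_subdiff_def mem_Collect_eq using lim
    by (intro exI[of _ "\<lambda>j. x (s j)"] exI[of _ "\<lambda>j. g (s j)"] conjI)
  then show ?thesis
    using that s lim \<open>z \<in> C\<close> l \<open>l = f z\<close> by blast
qed

text \<open>
  The gradient gap is the subgradient to which the inequality is applied, and the Lipschitz constant
  bounds it by the last step.
\<close>

lemma KL_along_iterates:
  assumes ineq: "\<And>y g. y \<in> U \<Longrightarrow> y \<in> C \<Longrightarrow> g \<in> limiting_subdiff F y \<Longrightarrow> 0 < f y - f z \<Longrightarrow>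
      ereal (f y - f z) < \<eta> \<Longrightarrow> 1 \<le> deriv \<phi> (f y - f z) * norm g"
    and \<phi>: "desingularizing \<eta> \<phi>"
    and xk: "w (Suc k) \<in> U" "0 < f (w (Suc k)) - f z" "ereal (f (w (Suc k)) - f z) < \<eta>"
  shows "1 \<le> deriv \<phi> (f (w (Suc k)) - f z) * (L * dist (w (Suc k)) (w k))"
proof -
  let ?p = "deriv \<phi> (f (w (Suc k)) - f z)"
  have "grad v (w k) - grad v (w (Suc k)) \<in> limiting_subdiff F (w (Suc k))"
    using gradient_gap_in_subdiff frechet_subdiff_subset_limiting by blast
  then have "1 \<le> ?p * norm (grad v (w k) - grad v (w (Suc k)))"
    using ineq[OF xk(1) feasible _ xk(2,3)] by blast
  also have "0 \<le> ?p"
    using \<phi> xk by (auto simp: desingularizing_def Let_def intro: less_imp_le)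
  then have "?p * norm (grad v (w k) - grad v (w (Suc k))) \<le> ?p * (L * dist (w (Suc k)) (w k))"
    using L(2)[of "w k" "w (Suc k)"] by (intro mult_left_mono) (simp_all add: dist_commute)
  finally show ?thesis .
qed

context
  fixes z s
  assumes cluster: "strict_mono s" "(\<lambda>j. x (s j)) \<longlonglongrightarrow> z" "z \<in> C" and f_lim: "(\<lambda>k. f (x k)) \<longlonglongrightarrow> f z"
begin

abbreviation r :: "nat \<Rightarrow> real" where "r k \<equiv> f (x k) - f z"

lemma r_lim: "r \<longlonglongrightarrow> 0"
  using f_lim by (simp add: LIM_zero)

lemma r_nonneg: "0 \<le> r k"
  using decseq_ge[OF decseq_f f_lim] by simp

lemma decseq_r: "decseq r"
  using decseq_f by (simp add: decseq_def)

lemma KL_convergence: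
  assumes "KL_with F z \<phi>"
  shows "summable (\<lambda>k. dist (x (Suc k)) (x k))"
    and "x \<longlonglongrightarrow> z"
    and "\<forall>\<^sub>F k in sequentially.
      dist (x (Suc k)) z \<le> dist (x (Suc k)) (x k) + L / (\<gamma> / 2) * \<phi> (r (Suc k))"
proof -
  obtain \<eta> U where \<eta>: "0 < \<eta>" "desingularizing \<eta> \<phi>" and U: "open U" "z \<in> U"
    and ineq: "\<And>y g. y \<in> U \<Longrightarrow> y \<in> C \<Longrightarrow> g \<in> limiting_subdiff F y \<Longrightarrow> 0 < f y - f z \<Longrightarrow>
      ereal (f y - f z) < \<eta> \<Longrightarrow> 1 \<le> deriv \<phi> (f y - f z) * norm g"
    using KL_with_dc_objective[OF assms cluster(3)] by metis
  have "0 < \<gamma> / 2"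
    using u(3) by simp
  have drop: "\<gamma> / 2 * (dist (x (Suc k)) (x k))\<^sup>2 \<le> r k - r (Suc k)" for k
    using descent[of k] by simp
  note length = KL_finite_length[OF \<eta>(2) \<open>0 < \<gamma> / 2\<close> L(1) \<eta>(1) U r_nonneg r_lim drop
      KL_along_iterates[OF ineq \<eta>(2)] cluster(1,2)]
  show "summable (\<lambda>k. dist (x (Suc k)) (x k))"
    and "x \<longlonglongrightarrow> z"
    and "\<forall>\<^sub>F k in sequentially.
      dist (x (Suc k)) z \<le> dist (x (Suc k)) (x k) + L / (\<gamma> / 2) * \<phi> (r (Suc k))"
    by (rule length; assumption)+
qed

text \<open>
  With \<open>\<phi>'(t) = a (1-\<theta>) t^(-\<theta>)\<close> the inequality reads \<open>r(k+1)^\<theta> \<le> M dist (x(k+1)) (x k)\<close>; its square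
  is bounded by the sufficient decrease. If the gap has already closed, the recursion holds because
  the real power of zero is zero, also for the exponent zero.
\<close>

lemma KL_power_recursion:
  assumes KL: "KL_with F z (\<lambda>t. a * t powr (1 - \<theta>))" and a: "0 < a" and \<theta>: "0 \<le> \<theta>" "\<theta> < 1"
  shows "\<exists>A>0. \<forall>\<^sub>F k in sequentially. r (Suc k) powr (2 * \<theta>) \<le> A * (r k - r (Suc k))"
proof -
  let ?\<phi> = "\<lambda>t. a * t powr (1 - \<theta>)"
  obtain \<eta> U where \<eta>: "0 < \<eta>" "desingularizing \<eta> ?\<phi>" and U: "open U" "z \<in> U"
    and ineq: "\<And>y g. y \<in> U \<Longrightarrow> y \<in> C \<Longrightarrow> g \<in> limiting_subdiff F y \<Longrightarrow> 0 < f y - f z \<Longrightarrow>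
      ereal (f y - f z) < \<eta> \<Longrightarrow> 1 \<le> deriv ?\<phi> (f y - f z) * norm g"
    using KL_with_dc_objective[OF KL cluster(3)] by metis
  have deriv: "deriv ?\<phi> t = a * (1 - \<theta>) * t powr (- \<theta>)" if "0 < t" for t
    using that by (intro DERIV_imp_deriv) (auto intro!: derivative_eq_intros)
  define M where "M = a * (1 - \<theta>) * L"
  have "0 < M"
    using a \<theta> L by (simp add: M_def)
  have "\<forall>\<^sub>F k in sequentially. x k \<in> U"
    using KL_convergence(2)[OF KL] U by (rule topological_tendstoD)
  then have "\<forall>\<^sub>F k in sequentially. x (Suc k) \<in> U"
    by (rule eventually_sequentially_Suc[THEN iffD2])
  moreover have "\<forall>\<^sub>F k in sequentially. ereal (r (Suc k)) < \<eta>"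
    using LIMSEQ_Suc[OF r_lim] \<eta>(1) by (intro order_tendstoD(2)) (auto simp: zero_ereal_def)
  ultimately have "\<forall>\<^sub>F k in sequentially. r (Suc k) powr (2 * \<theta>) \<le> M\<^sup>2 / (\<gamma> / 2) * (r k - r (Suc k))"
  proof eventually_elim
    case (elim k)
    let ?d = "dist (x (Suc k)) (x k)"
    have drop: "?d\<^sup>2 \<le> (r k - r (Suc k)) / (\<gamma> / 2)"
      using descent[of k] u(3) by (simp add: field_simps)
    have "r (Suc k) powr (2 * \<theta>) \<le> M\<^sup>2 * ?d\<^sup>2"
    proof (cases "r (Suc k) = 0")
      case False
      then have "0 < r (Suc k)"
        using r_nonneg[of "Suc k"] by linarith
      then have "1 \<le> M * ?d * r (Suc k) powr (- \<theta>)"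
        using KL_along_iterates[OF ineq \<eta>(2) elim(1) _ elim(2)] by (simp add: deriv M_def mult_ac)
      then have "r (Suc k) powr \<theta> \<le> M * ?d"
        using \<open>0 < r (Suc k)\<close> by (simp add: powr_minus field_simps)
      then have "(r (Suc k) powr \<theta>)\<^sup>2 \<le> (M * ?d)\<^sup>2"
        by (intro power_mono) auto
      then show ?thesis
        by (simp add: power2_eq_square mult_ac flip: powr_add)
    qed simp
    also have "\<dots> \<le> M\<^sup>2 * ((r k - r (Suc k)) / (\<gamma> / 2))"
      using drop by (intro mult_left_mono) auto
    finally show ?case
      by (simp only: times_divide_eq_left times_divide_eq_right)
  qed
  moreover have "0 < M\<^sup>2 / (\<gamma> / 2)"
    using \<open>0 < M\<close> u(3) by simp
  ultimately show ?thesis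
    by blast
qed

text \<open>
  Both parts of the energy are powers of the gap: the step is at most the square root of the gap divided
  by \<open>\<gamma>/2\<close>, and \<open>\<phi>\<close> contributes the power \<open>1-\<theta>\<close>. For gaps below one the smaller exponent dominates.
\<close>

lemma KL_power_distance:
  assumes KL: "KL_with F z (\<lambda>t. a * t powr (1 - \<theta>))" and a: "0 < a" and \<theta>: "0 \<le> \<theta>" "\<theta> < 1"
  shows "\<exists>D>0. \<forall>\<^sub>F k in sequentially. dist (x (Suc k)) z \<le> D * r k powr (min (1 / 2) (1 - \<theta>))"
proof -
  let ?m = "min (1 / 2) (1 - \<theta>)" and ?\<sigma> = "\<gamma> / 2"
  have "0 < ?\<sigma>"
    using u(3) by simp
  have "\<forall>\<^sub>F k in sequentially. r k < 1"
    using r_lim by (rule order_tendstoD) simp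
  with KL_convergence(3)[OF KL]
  have "\<forall>\<^sub>F k in sequentially. dist (x (Suc k)) z \<le> (1 / sqrt ?\<sigma> + L / ?\<sigma> * a) * r k powr ?m"
  proof eventually_elim
    case (elim k)
    have r: "0 \<le> r k" "r k \<le> 1" "r (Suc k) \<le> r k"
      using elim(2) r_nonneg decseq_SucD[OF decseq_r] by auto
    have "(dist (x (Suc k)) (x k))\<^sup>2 \<le> r k / ?\<sigma>"
      using descent[of k] \<open>0 < ?\<sigma>\<close> r_nonneg[of "Suc k"] by (simp add: field_simps)
    then have "dist (x (Suc k)) (x k) \<le> sqrt (r k / ?\<sigma>)"
      by (rule real_le_rsqrt)
    also have "\<dots> = r k powr (1 / 2) / sqrt ?\<sigma>"
      using r by (simp only: powr_half_sqrt real_sqrt_divide)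
    also have "\<dots> \<le> r k powr ?m / sqrt ?\<sigma>"
      using r \<open>0 < ?\<sigma>\<close> by (intro divide_right_mono powr_mono'[OF min.cobounded1]) auto
    finally have 1: "dist (x (Suc k)) (x k) \<le> 1 / sqrt ?\<sigma> * r k powr ?m"
      by simp
    have "r (Suc k) powr (1 - \<theta>) \<le> r k powr (1 - \<theta>)"
      using r r_nonneg \<theta> by (intro powr_mono2) auto
    also have "\<dots> \<le> r k powr ?m"
      using r by (intro powr_mono') auto
    finally have "L / ?\<sigma> * a * r (Suc k) powr (1 - \<theta>) \<le> L / ?\<sigma> * a * r k powr ?m"
      using L(1) a \<open>0 < ?\<sigma>\<close> by (intro mult_left_mono) auto
    with 1 elim(1) show ?case
      unfolding distrib_right mult.assoc by linarith
  qed
  moreover have "0 < 1 / sqrt ?\<sigma> + L / ?\<sigma> * a"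
    using L(1) a \<open>0 < ?\<sigma>\<close> by (intro add_pos_pos) auto
  ultimately show ?thesis
    by blast
qed

end

end

section \<open>Convergence and rates of convergence\<close>

theorem theorem21:
  fixes u v :: "real ^ 'p \<Rightarrow> real"
    and c d :: "nat \<Rightarrow> real ^ 'p \<Rightarrow> real"
    and n m :: nat
    and C :: "(real ^ 'p) set"
    and F :: "real ^ 'p \<Rightarrow> ereal"
    and \<gamma> :: real
    and w :: "nat \<Rightarrow> real ^ 'p"
  assumes u_convex: "convex_on UNIV u"
    and v_convex: "convex_on UNIV v"
    and c_convex: "\<And>i. i \<in> {1..n} \<Longrightarrow> convex_on UNIV (c i)"
    and d_affine: "\<And>j. j \<in> {1..m} \<Longrightarrow> affine_fun (d j)"
    and C_eq: "C = feasible_set n m c d"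
    and F_eq: "F = dc_objective C u v"
    and F_lsc: "lsc F"
    and F_coercive: "coercive F"
    and F_bounded_below: "(INF x. F x) > -\<infinity>"
    and u_C1: "C1_fun u"
    and v_C1: "C1_fun v"
    and gamma_pos: "\<gamma> > 0"
    and u_strongly_convex: "strongly_convex \<gamma> u"
    and grad_v_lipschitz: "\<exists>L. L-lipschitz_on UNIV (grad v)"
    and F_proper: "proper F"
    and F_KL: "\<forall>x\<in>dom_subdiff F. KL_at F x"
    and w_step: "\<And>k. is_arg_min
        (\<lambda>x. indicator_infty C x + ereal (u x) - ereal (grad v (w k) \<bullet> x)) (\<lambda>_. True) (w (Suc k))"
  shows "summable (\<lambda>k. norm (w (Suc k) - w k)) \<and>
    (\<exists>wstar. w \<longlonglongrightarrow> wstar \<and> critical_point F wstar \<and>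
      (\<forall>\<theta>::real. 0 \<le> \<theta> \<and> \<theta> < 1 \<and>
          (\<forall>x\<in>dom_subdiff F. \<exists>a>0. KL_with F x (\<lambda>t. a * t powr (1 - \<theta>))) \<longrightarrow>
        (\<theta> = 0 \<longrightarrow> (\<exists>K. \<forall>k\<ge>K. w k = wstar)) \<and>
        (0 < \<theta> \<and> \<theta> \<le> 1 / 2 \<longrightarrow>
          (\<exists>K0>0. \<exists>B>0. \<exists>\<rho>. 0 < \<rho> \<and> \<rho> < 1 \<and>
             (\<forall>k\<ge>K0. norm (w k - wstar) \<le> B * \<rho> ^ k))) \<and>
        (1 / 2 < \<theta> \<and> \<theta> < 1 \<longrightarrow>
          (\<exists>K0>0. \<exists>B>0. \<forall>k\<ge>K0.
             norm (w k - wstar) \<le> B * real k powr (- (1 - \<theta>) / (2 * \<theta> - 1))))))"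
proof -
  obtain L0 where "L0-lipschitz_on UNIV (grad v)"
    using grad_v_lipschitz by blast
  then have L0: "0 \<le> L0" "\<And>x y. dist (grad v x) (grad v y) \<le> L0 * dist x y"
    by (auto simp: lipschitz_on_def)
  \<comment> \<open>A positive constant keeps the coefficient of the recursion for the gap positive.\<close>
  define L where "L = L0 + 1"
  have L: "0 < L" "norm (grad v x - grad v y) \<le> L * dist x y" for x y
  proof -
    show "0 < L"
      using L0(1) by (simp add: L_def)
    have "dist (grad v x) (grad v y) \<le> L * dist x y"
      using L0(2)[of x y] zero_le_dist[of x y] unfolding L_def distrib_right by linarith
    then show "norm (grad v x - grad v y) \<le> L * dist x y"
      by (simp add: dist_norm)
  qed
  have "C \<noteq> {}"
    using F_proper by (auto simp: proper_def eff_dom_def F_eq dc_objective_off)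
  interpret dc_algorithm C u v \<gamma> L w
  proof
    show "closed C" "convex C"
      unfolding C_eq using closed_feasible_set convex_feasible_set c_convex d_affine by blast+
    show "continuous_on UNIV u"
      using u_convex by (simp add: convex_on_continuous)
    show "v differentiable (at x)" for x
      using v_C1 by (simp add: C1_fun_def)
    show "w (Suc k) \<in> C" for k
      using is_arg_min_indicator_linear(1)[OF \<open>C \<noteq> {}\<close> w_step] .
    show "u (w (Suc k)) - grad v (w k) \<bullet> w (Suc k) \<le> u y - grad v (w k) \<bullet> y" if "y \<in> C" for k y
      using is_arg_min_indicator_linear(2)[OF \<open>C \<noteq> {}\<close> w_step that] .
  qed (use u_strongly_convex gamma_pos v_convex L in auto)
  obtain z s where cluster: "strict_mono s" "(\<lambda>j. w (Suc (s j))) \<longlonglongrightarrow> z" "z \<in> C"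
      "(\<lambda>k. u (w (Suc k)) - v (w (Suc k))) \<longlonglongrightarrow> u z - v z"
    and crit: "critical_point F z"
    using critical_cluster_point F_coercive unfolding F_eq by blast
  have z: "z \<in> dom_subdiff F"
    using crit by (auto simp: critical_point_def dom_subdiff_def)
  then obtain \<phi> where \<phi>: "KL_with (dc_objective C u v) z \<phi>"
    using F_KL unfolding KL_at_def F_eq by blast
  have "summable (\<lambda>k. dist (w (Suc (Suc k))) (w (Suc k)))"
    by (rule KL_convergence(1)[OF cluster \<phi>])
  then have "summable (\<lambda>k. dist (w (Suc k)) (w k))"
    by (rule summable_Suc_iff[THEN iffD1])
  then have length: "summable (\<lambda>k. norm (w (Suc k) - w k))"
    by (simp add: dist_norm)
  have lim: "w \<longlonglongrightarrow> z"
    using KL_convergence(2)[OF cluster \<phi>] by (rule filterlim_sequentially_Suc[THEN iffD1])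
  have rates: "(\<theta> = 0 \<longrightarrow> (\<exists>K. \<forall>k\<ge>K. w k = z)) \<and>
        (0 < \<theta> \<and> \<theta> \<le> 1 / 2 \<longrightarrow>
          (\<exists>K0>0. \<exists>B>0. \<exists>\<rho>. 0 < \<rho> \<and> \<rho> < 1 \<and>
             (\<forall>k\<ge>K0. norm (w k - z) \<le> B * \<rho> ^ k))) \<and>
        (1 / 2 < \<theta> \<and> \<theta> < 1 \<longrightarrow>
          (\<exists>K0>0. \<exists>B>0. \<forall>k\<ge>K0.
             norm (w k - z) \<le> B * real k powr (- (1 - \<theta>) / (2 * \<theta> - 1))))"
    if \<theta>: "0 \<le> \<theta>" "\<theta> < 1"
      and KL: "\<forall>x\<in>dom_subdiff F. \<exists>a>0. KL_with F x (\<lambda>t. a * t powr (1 - \<theta>))" for \<theta> :: real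
  proof -
    obtain a where a: "0 < a" "KL_with (dc_objective C u v) z (\<lambda>t. a * t powr (1 - \<theta>))"
      using KL z unfolding F_eq by blast
    obtain A where A: "0 < A" "\<forall>\<^sub>F k in sequentially. r z (Suc k) powr (2 * \<theta>) \<le> A * (r z k - r z (Suc k))"
      using KL_power_recursion[OF cluster a(2,1) \<theta>] by blast
    obtain D where D: "0 < D" "\<forall>\<^sub>F k in sequentially.
        norm (w (Suc (Suc k)) - z) \<le> D * r z k powr (min (1 / 2) (1 - \<theta>))"
      using KL_power_distance[OF cluster a(2,1) \<theta>] unfolding dist_norm by blast
    note decay = rates_from_KL_recursion[OF r_nonneg[OF cluster] decseq_r[OF cluster] r_lim[OF cluster]
        A(1) D(1) \<theta> A(2) D(2)]
    have "\<exists>K. \<forall>k\<ge>K. w k = z" if "\<theta> = 0"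
    proof -
      have "\<forall>\<^sub>F k in sequentially. w (Suc (Suc k)) = z"
        using decay(1)[OF that] by simp
      then have "\<forall>\<^sub>F k in sequentially. w k = z"
        by (subst (asm) eventually_sequentially_Suc, subst (asm) eventually_sequentially_Suc)
      then show ?thesis
        by (simp add: eventually_sequentially)
    qed
    moreover have "\<exists>K0>0. \<exists>B>0. \<exists>\<rho>. 0 < \<rho> \<and> \<rho> < 1 \<and> (\<forall>k\<ge>K0. norm (w k - z) \<le> B * \<rho> ^ k)"
      if \<theta>: "0 < \<theta>" "\<theta> \<le> 1 / 2"
    proof -
      obtain B \<rho> where "0 < B" "0 < \<rho>" "\<rho> < 1"
        "\<forall>\<^sub>F k in sequentially. norm (w (Suc (Suc k)) - z) \<le> B * \<rho> ^ k"
        using decay(2)[OF \<theta>] by blast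
      then show ?thesis
        using geometric_bound_shift[of B \<rho> "\<lambda>k. norm (w k - z)"] by blast
    qed
    moreover have "\<exists>K0>0. \<exists>B>0. \<forall>k\<ge>K0.
        norm (w k - z) \<le> B * real k powr (- (1 - \<theta>) / (2 * \<theta> - 1))" if \<theta>_half: "1 / 2 < \<theta>"
    proof -
      obtain B where "0 < B" "\<forall>\<^sub>F k in sequentially.
          norm (w (Suc (Suc k)) - z) \<le> B * real k powr (- (1 - \<theta>) / (2 * \<theta> - 1))"
        using decay(3)[OF \<theta>_half] by blast
      moreover have "- (1 - \<theta>) / (2 * \<theta> - 1) \<le> 0"
        using \<theta>_half \<theta> by (intro divide_nonpos_pos) auto
      ultimately show ?thesis
        using polynomial_bound_shift[of B _ "\<lambda>k. norm (w k - z)"] by blast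
    qed
    ultimately show ?thesis
      by blast
  qed
  show ?thesis
    by (rule conjI[OF length exI[where x = z]], rule conjI[OF lim conjI[OF crit]],
        intro allI impI, elim conjE, rule rates; assumption)
qed

end
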